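(* Let $\bar d\in\mathcal D(v,r;k_1,k_2)$ be an $\mathrm{ECD}(\bar\theta)$. If $d\in\mathcal D(v,r;k_1,k_2)$ is a design whose information matrix $C_d$ has a different multiset of eigenvalues from that of $C_{\bar d}$, then $\bar d$ is Schur-better than $d$ if and only if $\psi_F(\bar d)\le\psi_F(d)$. Consequently, $\bar d$ is Schur-optimal if and only if it is F-optimal.
   Context: Let $k_1\ge k_2\ge 2$ be integers, $v=k_1+k_2$, and $2\le r\le v-1$. A resolvable design $d$ consists of $r$ replicates, each replicate being a partition of a fixed set of $v$ treatments into two blocks, one of size $k_1$ and one of size $k_2$ (if $k_1=k_2$, one block of each replicate is designated as "the block of size $k_1$"). Let $N_d$ be the $v\times 2r$ zero-one treatment/block incidence matrix, $D_s=\mathrm{Diag}(k_1,k_2,k_1,k_2,\dots,k_1,k_2)$ the diagonal matrix of block sizes, and $C_d=rI-N_dD_s^{-1}N_d'$ the information matrix. The design is connected if $C_d$ has rank $v-1$; only connected designs are considered, and $\mathcal D=\mathcal D(v,r;k_1,k_2)$ denotes the class of all of them. The nonzero eigenvalues of $C_d$ are $z_{d1}\le z_{d2}\le\dots\le z_{d,v-1}$. For $h\ne h'$, $\phi_{dhh'}$ is the number of treatments common to the blocks of size $k_1$ in replicates $h$ and $h'$. A design $d$ is an equal concurrence design $\mathrm{ECD}(\theta)$ if $\phi_{dhh'}=\theta$ for all $h\neq h'$. Put $\bar\theta=\lfloor k_1^2/(k_1+k_2)\rfloor$. Let $M_d$ be the $r\times r$ symmetric matrix with diagonal entries $k_1k_2/v$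 and off-diagonal entries $\phi_{dhh'}-k_1^2/v$, with eigenvalues $e_{d1}\ge\dots\ge e_{dr}$. The F-criterion is $\psi_F(d)=z_{dr}=r-\frac{v e_{dr}}{k_1k_2}$ (the largest eigenvalue of $C_d$ other than the $v-r-1$ eigenvalues forced to equal $r$ for every design). A design is F-optimal if it minimizes $\psi_F$ over $\mathcal D$. For convex $f:(0,\infty)\to\mathbb R$ let $\psi_f(d)=\sum_{i=1}^{v-1}f(z_{di})$. Design $d_1$ is Schur-better than $d_2$ if $\psi_f(d_1)\le\psi_f(d_2)$ for all convex $f$, with strict inequality for at least one $f$. A design is Schur-optimal if it minimizes $\psi_f$ over $\mathcal D$ for every convex $f$. *)

theory Defs
  imports
    "HOL-Analysis.Convex"
    "HOL-Library.Multiset"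
    "HOL-Computational_Algebra.Polynomial"
    "Jordan_Normal_Form.Char_Poly"
    "Jordan_Normal_Form.DL_Rank"
    "Jordan_Normal_Form.Gauss_Jordan_Elimination"
begin

text \<open>
  The treatments are \<open>0, \<dots>, v - 1\<close>. A replicate is an ordered pair of blocks whose first component
  is the block of size \<open>k1\<close>; for \<open>k1 = k2\<close> the order of the pair designates that block.
  A design is the list of its replicates, indexed from \<open>0\<close>.
\<close>

type_synonym replicate = "nat set \<times> nat set"
type_synonym design = "replicate list"

definition is_replicate :: "nat \<Rightarrow> nat \<Rightarrow> nat \<Rightarrow> replicate \<Rightarrow> bool" where
  "is_replicate v k1 k2 R \<longleftrightarrow>
     fst R \<union> snd R = {..<v} \<and> fst R \<inter> snd R = {} \<and> card (fst R) = k1 \<and> card (snd R) = k2"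

definition resolvable_design :: "nat \<Rightarrow> nat \<Rightarrow> nat \<Rightarrow> nat \<Rightarrow> design \<Rightarrow> bool" where
  "resolvable_design v r k1 k2 d \<longleftrightarrow> length d = r \<and> (\<forall>h<r. is_replicate v k1 k2 (d ! h))"

text \<open>Column \<open>2 h\<close> of the incidence matrix is the block of size \<open>k1\<close> of replicate \<open>h\<close>,
  column \<open>2 h + 1\<close> its block of size \<open>k2\<close>.\<close>

definition block :: "design \<Rightarrow> nat \<Rightarrow> nat set" where
  "block d j = (if even j then fst (d ! (j div 2)) else snd (d ! (j div 2)))"

definition incidence_mat :: "nat \<Rightarrow> nat \<Rightarrow> design \<Rightarrow> real mat" where
  "incidence_mat v r d = mat v (2 * r) (\<lambda>(i, j). if i \<in> block d j then 1 else 0)"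

definition block_size_mat :: "nat \<Rightarrow> nat \<Rightarrow> nat \<Rightarrow> real mat" where
  "block_size_mat r k1 k2 = mat_diag (2 * r) (\<lambda>j. if even j then real k1 else real k2)"

lemma block_size_mat_inverse:
  assumes "k1 > 0" and "k2 > 0"
  shows "mat_inverse (block_size_mat r k1 k2) =
    Some (mat_diag (2 * r) (\<lambda>j. if even j then 1 / real k1 else 1 / real k2))"
proof -
  let ?A = "block_size_mat r k1 k2"
  let ?B = "mat_diag (2 * r) (\<lambda>j. if even j then 1 / real k1 else 1 / real k2)"
  have A: "?A \<in> carrier_mat (2 * r) (2 * r)"
    by (simp add: block_size_mat_def)
  have B: "?B \<in> carrier_mat (2 * r) (2 * r)"
    by simp
  have AB: "?A * ?B = 1\<^sub>m (2 * r)" and BA: "?B * ?A = 1\<^sub>m (2 * r)"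
    unfolding block_size_mat_def mat_diag_diag using assms
    by (auto simp: mat_diag_def)
  have "?A \<in> Units (ring_mat TYPE(real) (2 * r) ())"
    using A B AB BA unfolding Units_def by (auto simp: ring_mat_def)
  then obtain C where C: "mat_inverse ?A = Some C"
    using mat_inverse(1)[OF A, where b = "()"] by (cases "mat_inverse ?A") auto
  have CA: "C * ?A = 1\<^sub>m (2 * r)" and Cc: "C \<in> carrier_mat (2 * r) (2 * r)"
    using mat_inverse(2)[OF A C] by auto
  have "C = C * (?A * ?B)"
    unfolding AB by (rule right_mult_one_mat[OF Cc, symmetric])
  also have "\<dots> = C * ?A * ?B"
    by (rule assoc_mult_mat[OF Cc A B, symmetric])
  also have "\<dots> = ?B"
    unfolding CA by (rule left_mult_one_mat[OF B])
  finally show ?thesis unfolding C by (rule arg_cong)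
qed

definition information_mat :: "nat \<Rightarrow> nat \<Rightarrow> nat \<Rightarrow> nat \<Rightarrow> design \<Rightarrow> real mat" where
  "information_mat v r k1 k2 d =
     real r \<cdot>\<^sub>m 1\<^sub>m v -
     incidence_mat v r d * the (mat_inverse (block_size_mat r k1 k2)) * transpose_mat (incidence_mat v r d)"

definition connected_design :: "nat \<Rightarrow> nat \<Rightarrow> nat \<Rightarrow> nat \<Rightarrow> design \<Rightarrow> bool" where
  "connected_design v r k1 k2 d \<longleftrightarrow> vec_space.rank v (information_mat v r k1 k2 d) = v - 1"

definition design_class :: "nat \<Rightarrow> nat \<Rightarrow> nat \<Rightarrow> nat \<Rightarrow> design set" where
  "design_class v r k1 k2 = {d. resolvable_design v r k1 k2 d \<and> connected_design v r k1 k2 d}"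

text \<open>Multiset of eigenvalues with multiplicity. For the symmetric real matrices used here all
  complex roots of the characteristic polynomial are real.\<close>

definition eigenvalue_mset :: "real mat \<Rightarrow> real multiset" where
  "eigenvalue_mset A = proots (char_poly A)"

text \<open>\<open>z v r k1 k2 d i\<close> is the \<open>i\<close>-th smallest nonzero eigenvalue of the information matrix,
  counted from \<open>i = 1\<close> and with multiplicity.\<close>

definition z :: "nat \<Rightarrow> nat \<Rightarrow> nat \<Rightarrow> nat \<Rightarrow> design \<Rightarrow> nat \<Rightarrow> real" where
  "z v r k1 k2 d i =
     sorted_list_of_multiset
       (filter_mset (\<lambda>x. x \<noteq> 0) (eigenvalue_mset (information_mat v r k1 k2 d))) ! (i - 1)"

definition phi :: "design \<Rightarrow> nat \<Rightarrow> nat \<Rightarrow> nat" where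
  "phi d h h' = card (fst (d ! h) \<inter> fst (d ! h'))"

definition equal_concurrence :: "nat \<Rightarrow> nat \<Rightarrow> design \<Rightarrow> bool" where
  "equal_concurrence r \<theta> d \<longleftrightarrow> (\<forall>h<r. \<forall>h'<r. h \<noteq> h' \<longrightarrow> phi d h h' = \<theta>)"

definition theta_bar :: "nat \<Rightarrow> nat \<Rightarrow> nat" where
  "theta_bar k1 k2 = nat \<lfloor>real (k1\<^sup>2) / real (k1 + k2)\<rfloor>"

definition psi_F :: "nat \<Rightarrow> nat \<Rightarrow> nat \<Rightarrow> nat \<Rightarrow> design \<Rightarrow> real" where
  "psi_F v r k1 k2 d = z v r k1 k2 d r"

definition F_optimal :: "nat \<Rightarrow> nat \<Rightarrow> nat \<Rightarrow> nat \<Rightarrow> design \<Rightarrow> bool" where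
  "F_optimal v r k1 k2 d \<longleftrightarrow> d \<in> design_class v r k1 k2 \<and>
     (\<forall>d' \<in> design_class v r k1 k2. psi_F v r k1 k2 d \<le> psi_F v r k1 k2 d')"

text \<open>Functions on the positive reals are represented by total functions; only their values at the
  positive numbers \<open>z v r k1 k2 d i\<close> enter \<open>psi\<close>.\<close>

definition psi :: "nat \<Rightarrow> nat \<Rightarrow> nat \<Rightarrow> nat \<Rightarrow> (real \<Rightarrow> real) \<Rightarrow> design \<Rightarrow> real" where
  "psi v r k1 k2 f d = (\<Sum>i = 1..v - 1. f (z v r k1 k2 d i))"

definition Schur_better :: "nat \<Rightarrow> nat \<Rightarrow> nat \<Rightarrow> nat \<Rightarrow> design \<Rightarrow> design \<Rightarrow> bool" where
  "Schur_better v r k1 k2 d1 d2 \<longleftrightarrow>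
     (\<forall>f. convex_on {0<..} f \<longrightarrow> psi v r k1 k2 f d1 \<le> psi v r k1 k2 f d2) \<and>
     (\<exists>f. convex_on {0<..} f \<and> psi v r k1 k2 f d1 < psi v r k1 k2 f d2)"

definition Schur_optimal :: "nat \<Rightarrow> nat \<Rightarrow> nat \<Rightarrow> nat \<Rightarrow> design \<Rightarrow> bool" where
  "Schur_optimal v r k1 k2 d \<longleftrightarrow> d \<in> design_class v r k1 k2 \<and>
     (\<forall>f. convex_on {0<..} f \<longrightarrow>
       (\<forall>d' \<in> design_class v r k1 k2. psi v r k1 k2 f d \<le> psi v r k1 k2 f d'))"

end

theory Submission
  imports Defs "Jordan_Normal_Form.Schur_Decomposition"
begin

text \<open>
  Write \<open>a = k1 k2 / v\<close> and let \<open>u\<^sub>h\<close> be the indicator of the block of size \<open>k1\<close> of replicate \<open>h\<close>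
  minus its mean \<open>k1 / v\<close>. Projecting onto the two block indicators of a replicate is projecting
  onto the constants and onto \<open>u\<^sub>h\<close>, whose squared norm is \<open>a\<close>, so that
  \<open>C = r I - (r / v) J - (1 / a) U U'\<close>, where \<open>U\<close> has the columns \<open>u\<^sub>h\<close>. Since \<open>AB\<close> and \<open>BA\<close> have
  the same nonzero eigenvalues, the \<open>v\<close> eigenvalues of \<open>C\<close> are \<open>0\<close>, the forced value \<open>r\<close> with
  multiplicity \<open>v - 1 - r\<close>, and the \<open>r\<close> eigenvalues of the small matrix \<open>r I - (1 / a) U' U\<close>
  (lemma \<open>eigenvalue_mset_information_mat\<close>). These \<open>r\<close> free eigenvalues lie in \<open>(0, r]\<close>:
  positive semidefiniteness of the Gram matrix gives the upper bound, the Cauchy-Schwarz inequality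
  gives nonnegativity, and connectedness excludes \<open>0\<close>. Their sum is the trace \<open>r (r - 1)\<close>, the same
  for all designs. Because no eigenvalue exceeds \<open>r\<close>, the F-criterion is the largest free eigenvalue.

  For an equal concurrence design the small matrix is \<open>s I\<close> plus a multiple of the all-ones matrix.
  Its free eigenvalues are \<open>s\<close>, repeated \<open>r - 1\<close> times, and a single \<open>t\<close>; rounding \<open>k1\<^sup>2 / v\<close> down
  makes the off-diagonal Gram entries nonpositive, which means \<open>s \<le> t\<close>. So \<open>t\<close> is its F-criterion.

  The theorem is now a statement about lists with equal totals. Let \<open>Z\<close> be the largest free
  eigenvalue of a competitor. If \<open>t \<le> Z\<close>, averaging the other \<open>r - 1\<close> eigenvalues of the
  competitor does not increase convex sums, by Jensen's inequality, and neither does moving from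
  \<open>(mean, Z)\<close> inwards to \<open>(s, t)\<close> (lemma \<open>convex_sum_below_spread_list\<close>); the sum of squares
  strictly decreases unless the lists agree. Conversely, if \<open>Z < t\<close>, the convex function
  \<open>max 0 (x - Z)\<close> vanishes on the free eigenvalues of the competitor but is positive at \<open>t\<close>, and the
  forced eigenvalues contribute equally to both sides. Hence comparing all convex criteria is the same as
  comparing the F-criterion (lemma \<open>psi_le_iff_psi_F_le\<close>), which gives both parts at once.
\<close>

section \<open>Characteristic polynomials of products and of symmetric matrices\<close>

text \<open>
  Sylvester's determinant identity in homogeneous form. Both sides are \<open>y ^ m\<close> times the determinant
  of one block matrix with diagonal blocks \<open>y I\<close> and \<open>I\<close>, evaluated through its two Schur complements.
  Stating it over an integral domain allows \<open>y\<close> to be a polynomial.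
\<close>

lemma det_swap_product:
  fixes A B :: "'a :: idom mat"
  assumes A: "A \<in> carrier_mat n m" and B: "B \<in> carrier_mat m n"
  shows "y ^ m * det (y \<cdot>\<^sub>m 1\<^sub>m n + A * B) = y ^ n * det (y \<cdot>\<^sub>m 1\<^sub>m m + B * A)"
proof -
  let ?W = "four_block_mat (y \<cdot>\<^sub>m 1\<^sub>m n) A (- B) (1\<^sub>m m)"
  let ?R = "four_block_mat (1\<^sub>m n) (0\<^sub>m n m) B (1\<^sub>m m)"
  let ?L = "four_block_mat (1\<^sub>m n) (0\<^sub>m n m) B (y \<cdot>\<^sub>m 1\<^sub>m m)"
  have c: "y \<cdot>\<^sub>m 1\<^sub>m n \<in> carrier_mat n n" "- B \<in> carrier_mat m n" "1\<^sub>m m \<in> carrier_mat m m"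
    "1\<^sub>m n \<in> carrier_mat n n" "0\<^sub>m n m \<in> carrier_mat n m" "y \<cdot>\<^sub>m 1\<^sub>m m \<in> carrier_mat m m"
    using B by auto
  have W: "?W \<in> carrier_mat (n + m) (n + m)" and R: "?R \<in> carrier_mat (n + m) (n + m)"
    and L: "?L \<in> carrier_mat (n + m) (n + m)"
    by auto
  have 1: "?W * ?R = four_block_mat (y \<cdot>\<^sub>m 1\<^sub>m n + A * B) A (0\<^sub>m m n) (1\<^sub>m m)"
    unfolding mult_four_block_mat[OF c(1) A c(2,3) c(4,5) B c(3)]
    using A B by (intro cong_four_block_mat) auto
  have BA: "B * A + y \<cdot>\<^sub>m 1\<^sub>m m = y \<cdot>\<^sub>m 1\<^sub>m m + B * A"
    using A B by (intro comm_add_mat) auto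
  have 2: "?L * ?W = four_block_mat (y \<cdot>\<^sub>m 1\<^sub>m n) A (0\<^sub>m m n) (y \<cdot>\<^sub>m 1\<^sub>m m + B * A)"
    unfolding mult_four_block_mat[OF c(4,5) B c(6) c(1) A c(2,3)]
    using A B
    by (intro cong_four_block_mat) (auto simp: BA)
  have dR: "det ?R = 1"
    using B by (subst det_four_block_mat_upper_right_zero[of _ n _ m]) auto
  have dL: "det ?L = y ^ m"
    using B by (subst det_four_block_mat_upper_right_zero[of _ n _ m]) auto
  have "det ?W = det (?W * ?R)"
    unfolding det_mult[OF W R] dR by simp
  also have "\<dots> = det (y \<cdot>\<^sub>m 1\<^sub>m n + A * B)"
    unfolding 1 using A B by (subst det_four_block_mat_lower_left_zero[of _ n _ m]) auto
  finally have dW: "det ?W = det (y \<cdot>\<^sub>m 1\<^sub>m n + A * B)" .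
  have "y ^ m * det ?W = det (?L * ?W)"
    unfolding det_mult[OF L W] dL ..
  also have "\<dots> = y ^ n * det (y \<cdot>\<^sub>m 1\<^sub>m m + B * A)"
    unfolding 2 using A B by (subst det_four_block_mat_lower_left_zero[of _ n _ m]) auto
  finally show ?thesis unfolding dW .
qed

lemma char_poly_shift_matrix:
  fixes M :: "'a :: idom mat"
  assumes "M \<in> carrier_mat n n"
  shows "char_poly (c \<cdot>\<^sub>m 1\<^sub>m n - M) = det ([:- c, 1:] \<cdot>\<^sub>m 1\<^sub>m n + map_mat (\<lambda>a. [:a:]) M)"
  unfolding char_poly_defs
  by (rule arg_cong[of _ _ det], rule eq_matI) (use assms in auto)

lemma char_poly_swap_product:
  fixes A B :: "'a :: idom mat"
  assumes A: "A \<in> carrier_mat n m" and B: "B \<in> carrier_mat m n"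
  shows "[:- c, 1:] ^ m * char_poly (c \<cdot>\<^sub>m 1\<^sub>m n - A * B) = [:- c, 1:] ^ n * char_poly (c \<cdot>\<^sub>m 1\<^sub>m m - B * A)"
proof -
  have AB: "A * B \<in> carrier_mat n n" and BA: "B * A \<in> carrier_mat m m"
    using A B by auto
  show ?thesis
    unfolding char_poly_shift_matrix[OF AB] char_poly_shift_matrix[OF BA]
      map_poly_mult[OF A B] map_poly_mult[OF B A]
    by (rule det_swap_product) (use A B in auto)
qed

text \<open>
  For a complex eigenvector \<open>w\<close> the Hermitian form \<open>w\<^sup>* K w\<close> is its own conjugate, and it
  equals the eigenvalue times a positive real number.
\<close>

lemma symmetric_complex_eigenvalue_real:
  fixes K :: "real mat"
  assumes K: "K \<in> carrier_mat n n" and sym: "\<And>i j. i < n \<Longrightarrow> j < n \<Longrightarrow> K $$ (i, j) = K $$ (j, i)"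
    and ev: "eigenvalue (map_mat complex_of_real K) a"
  shows "a \<in> \<real>"
proof -
  from ev obtain w where w: "w \<in> carrier_vec n" "w \<noteq> 0\<^sub>v n"
    and eq: "map_mat complex_of_real K *\<^sub>v w = a \<cdot>\<^sub>v w"
    using K unfolding eigenvalue_def eigenvector_def by auto
  have row: "(\<Sum>j<n. complex_of_real (K $$ (i, j)) * w $ j) = a * w $ i" if "i < n" for i
  proof -
    have "(map_mat complex_of_real K *\<^sub>v w) $ i = (\<Sum>j<n. complex_of_real (K $$ (i, j)) * w $ j)"
      using K w that by (auto simp: scalar_prod_def atLeast0LessThan)
    then show ?thesis using eq w that by simp
  qed
  define q where "q = (\<Sum>i<n. \<Sum>j<n. cnj (w $ i) * (complex_of_real (K $$ (i, j)) * w $ j))"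
  define s where "s = (\<Sum>i<n. (cmod (w $ i))\<^sup>2)"
  have q: "q = a * complex_of_real s"
  proof -
    have "(\<Sum>j<n. cnj (w $ i) * (complex_of_real (K $$ (i, j)) * w $ j)) = a * of_real ((cmod (w $ i))\<^sup>2)"
      if "i < n" for i
    proof -
      have "(\<Sum>j<n. cnj (w $ i) * (complex_of_real (K $$ (i, j)) * w $ j)) = cnj (w $ i) * (a * w $ i)"
        unfolding sum_distrib_left[symmetric] row[OF that] ..
      then show ?thesis by (simp add: complex_norm_square mult_ac del: of_real_power)
    qed
    then show ?thesis
      unfolding q_def s_def of_real_sum sum_distrib_left by (intro sum.cong) auto
  qed
  have "cnj q = (\<Sum>i<n. \<Sum>j<n. cnj (w $ j) * (complex_of_real (K $$ (j, i)) * w $ i))"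
    unfolding q_def cnj_sum by (auto intro!: sum.cong simp: sym)
  also have "\<dots> = q" unfolding q_def by (rule sum.swap)
  finally have cq: "cnj q = q" .
  obtain i where i: "i < n" "w $ i \<noteq> 0"
    using w by (metis carrier_vecD eq_vecI index_zero_vec)
  have "0 < s"
    unfolding s_def using i by (intro sum_pos2[of _ i]) auto
  then have "cnj a = a"
    using cq unfolding q by simp
  then show ?thesis by (simp add: Reals_cnj_iff)
qed

text \<open>
  The complex characteristic polynomial splits and all its roots are real, so the factorization
  descends to the reals. This ensures that the multiset of real roots has full size.
\<close>

lemma char_poly_symmetric_splits:
  fixes K :: "real mat"
  assumes K: "K \<in> carrier_mat n n" and sym: "\<And>i j. i < n \<Longrightarrow> j < n \<Longrightarrow> K $$ (i, j) = K $$ (j, i)"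
  obtains es where "char_poly K = (\<Prod>e\<leftarrow>es. [:- e, 1:])" "length es = n"
proof -
  interpret hom: map_poly_inj_idom_hom complex_of_real ..
  let ?C = "map_mat complex_of_real K"
  have C: "?C \<in> carrier_mat n n" using K by simp
  obtain as where as: "char_poly ?C = (\<Prod>a\<leftarrow>as. [:- a, 1:])" "length as = n"
    using char_poly_factorized[OF C] by blast
  have "a \<in> \<real>" if "a \<in> set as" for a
  proof (rule symmetric_complex_eigenvalue_real[OF K sym])
    show "eigenvalue ?C a"
      unfolding eigenvalue_root_char_poly[OF C] as(1) using that
      by (induction as) auto
  qed
  then have "as = map complex_of_real (map Re as)"
    by (intro nth_equalityI) auto
  then obtain es where es: "as = map complex_of_real es" by blast
  have "map_poly complex_of_real (char_poly K) = (\<Prod>a\<leftarrow>as. [:- a, 1:])"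
    using as(1) of_real_hom.char_poly_hom[OF K, where ?'a = complex] by simp
  also have "\<dots> = map_poly complex_of_real (\<Prod>e\<leftarrow>es. [:- e, 1:])"
    unfolding es map_map
    by (induction es) (simp_all only: list.map prod_list.Nil prod_list.Cons hom.hom_mult hom.hom_one, simp)
  finally have "char_poly K = (\<Prod>e\<leftarrow>es. [:- e, 1:])"
    by (rule hom.injectivity)
  then show ?thesis using that es as(2) by simp
qed

lemma repeat_mset_single: "repeat_mset n {#x#} = replicate_mset n x"
  by (induction n) auto

lemma proots_linear_factors:
  fixes es :: "'a :: idom list"
  shows "proots (\<Prod>e\<leftarrow>es. [:- e, 1:]) = mset es"
proof (induction es)
  case (Cons e es)
  have "(\<Prod>e\<leftarrow>es. [:- e, 1:]) \<noteq> 0" by (auto simp: prod_list_zero_iff)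
  then have "proots ([:- e, 1:] * (\<Prod>e\<leftarrow>es. [:- e, 1:])) = proots [:- e, 1:] + mset es"
    unfolding Cons.IH[symmetric] by (intro proots_mult) auto
  then show ?case
    by (simp only: list.map prod_list.Cons proots_linear_factor) simp
qed simp

lemma sum_diag_mult_commute:
  fixes A B :: "'a :: comm_ring_1 mat"
  assumes "A \<in> carrier_mat n n" and "B \<in> carrier_mat n n"
  shows "(\<Sum>i<n. (A * B) $$ (i, i)) = (\<Sum>i<n. (B * A) $$ (i, i))"
proof -
  have "(\<Sum>i<n. (A * B) $$ (i, i)) = (\<Sum>i<n. \<Sum>j<n. A $$ (i, j) * B $$ (j, i))"
    using assms by (intro sum.cong) (auto simp: scalar_prod_def atLeast0LessThan)
  also have "\<dots> = (\<Sum>j<n. \<Sum>i<n. A $$ (i, j) * B $$ (j, i))" by (rule sum.swap)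
  also have "\<dots> = (\<Sum>i<n. (B * A) $$ (i, i))"
    using assms by (intro sum.cong) (auto simp: scalar_prod_def atLeast0LessThan mult.commute)
  finally show ?thesis .
qed

text \<open>Schur triangularization puts the roots on the diagonal, and the trace is invariant under conjugation.\<close>

lemma sum_roots_eq_trace:
  fixes K :: "real mat"
  assumes K: "K \<in> carrier_mat n n" and es: "char_poly K = (\<Prod>e\<leftarrow>es. [:- e, 1:])"
  shows "sum_list es = (\<Sum>i<n. K $$ (i, i))"
proof -
  obtain B P Q where BPQ: "schur_decomposition K es = (B, P, Q)"
    by (cases "schur_decomposition K es")
  from schur_decomposition[OF K es BPQ]
  have sim: "similar_mat_wit K B P Q" and diag: "diag_mat B = es" by auto
  note w = similar_mat_witD2[OF K sim]
  have "(\<Sum>i<n. K $$ (i, i)) = (\<Sum>i<n. (P * (B * Q)) $$ (i, i))"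
    using w by (simp add: assoc_mult_mat)
  also have "\<dots> = (\<Sum>i<n. (B * Q * P) $$ (i, i))"
    using w by (intro sum_diag_mult_commute) auto
  also have "B * Q * P = B"
    using w by (simp add: assoc_mult_mat[of _ n n _ n _ n])
  also have "(\<Sum>i<n. B $$ (i, i)) = sum_list (diag_mat B)"
    using w(5) by (simp add: diag_mat_def interv_sum_list_conv_sum_set_nat atLeast0LessThan)
  finally show ?thesis unfolding diag by simp
qed

section \<open>The kernel of a matrix of corank one\<close>

text \<open>
  A usable form of rank-nullity for a one-dimensional kernel: of \<open>n\<close> columns, \<open>n - 1\<close> form a
  basis of the column space, and \<open>j\<close> is the index of the remaining one. A kernel vector that vanishes at \<open>j\<close> is
  a linear relation between basis vectors.
\<close>

lemma rank_pred_kernel_coordinate: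
  fixes A :: "'a :: field mat"
  assumes A: "A \<in> carrier_mat n n" and rank: "vec_space.rank n A = n - 1" and "0 < n"
  obtains j where "j < n"
    "\<And>y. y \<in> carrier_vec n \<Longrightarrow> A *\<^sub>v y = 0\<^sub>v n \<Longrightarrow> y $ j = 0 \<Longrightarrow> y = 0\<^sub>v n"
proof -
  interpret vec_space "TYPE('a)" n .
  have "\<exists>S. finite S \<and> maximal S (\<lambda>T. T \<subseteq> set (cols A) \<and> lin_indpt T) \<and> {} \<subseteq> S"
    by (rule maximal_exists_superset[of "set (cols A)"])
      (auto simp: finite_lin_indpt2)
  then obtain S where S: "finite S" "maximal S (\<lambda>T. T \<subseteq> set (cols A) \<and> lin_indpt T)" by auto
  have card: "card S = n - 1"
    using rank_card_indpt[OF A S(2)] rank by simp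
  have sub: "S \<subseteq> set (cols A)" and indpt: "lin_indpt S"
    using S(2) by (auto simp: maximal_def)
  have Sc: "S \<subseteq> carrier_vec n"
    using sub cols_dim A by blast
  have "\<forall>s\<in>S. \<exists>i<n. col A i = s"
    using sub A by (force simp: cols_def)
  then obtain g where g: "\<And>s. s \<in> S \<Longrightarrow> g s < n \<and> col A (g s) = s"
    by metis
  have inj: "inj_on g S" by (metis g inj_onI)
  have "card (g ` S) = n - 1" using card inj by (simp add: card_image)
  moreover have gS: "g ` S \<subseteq> {..<n}" using g by auto
  ultimately have "card ({..<n} - g ` S) = 1"
    using \<open>0 < n\<close> S(1) by (simp add: card_Diff_subset)
  then obtain j where j: "{..<n} - g ` S = {j}" by (auto simp: card_1_singleton_iff)
  have jn: "j < n" "j \<notin> g ` S" using j by blast+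
  have split: "{..<n} = insert j (g ` S)" using j gS by blast
  show ?thesis
  proof (rule that[OF jn(1)])
    fix y assume y: "y \<in> carrier_vec n" "A *\<^sub>v y = 0\<^sub>v n" "y $ j = 0"
    have "lincomb (\<lambda>s. y $ g s) S = 0\<^sub>v n"
    proof (rule eq_vecI)
      fix i assume "i < dim_vec (0\<^sub>v n :: 'a vec)"
      then have i: "i < n" by simp
      have "lincomb (\<lambda>s. y $ g s) S $ i = (\<Sum>s\<in>S. y $ g s * s $ i)"
        by (rule lincomb_index[OF i Sc])
      also have "\<dots> = (\<Sum>s\<in>S. y $ g s * A $$ (i, g s))"
        using g A i by (intro sum.cong refl) (metis carrier_matD index_col)
      also have "\<dots> = (\<Sum>k\<in>g ` S. y $ k * A $$ (i, k))"
        by (simp add: sum.reindex[OF inj])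
      also have "\<dots> = (\<Sum>k<n. y $ k * A $$ (i, k))"
        unfolding split using jn S(1) y(3) by simp
      also have "\<dots> = (A *\<^sub>v y) $ i"
        using A y(1) i by (simp add: scalar_prod_def atLeast0LessThan mult.commute)
      finally show "lincomb (\<lambda>s. y $ g s) S $ i = 0\<^sub>v n $ i"
        using y(2) by simp
    qed (use Sc S(1) in \<open>auto intro: lincomb_dim\<close>)
    then have zero: "y $ g s = 0" if "s \<in> S" for s
      using lin_dep_crit[OF S(1) order.refl _ that, of "\<lambda>s. y $ g s"] indpt \<open>lincomb _ S = _\<close> by auto
    show "y = 0\<^sub>v n"
    proof (rule eq_vecI)
      fix i assume "i < dim_vec (0\<^sub>v n :: 'a vec)"
      then have "i \<in> insert j (g ` S)" unfolding split[symmetric] by simp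
      then show "y $ i = 0\<^sub>v n $ i"
        using zero y(3) gS jn(1) by auto
    qed (use y in auto)
  qed
qed

section \<open>Convex sums over lists with a prescribed total\<close>

text \<open>
  The majorization step. With \<open>m\<close> the mean of \<open>xs\<close>, Jensen's inequality replaces \<open>xs\<close> by copies of
  \<open>m\<close>; the equal totals force \<open>m \<le> s \<le> t \<le> Z\<close>, and the chord of \<open>f\<close> over \<open>[m, Z]\<close> bounds
  \<open>f s\<close> and \<open>f t\<close>. Being affine, the chord has equal sums over lists with equal totals.
\<close>

lemma convex_sum_below_spread_list:
  fixes f :: "real \<Rightarrow> real"
  assumes f: "convex_on {0<..} f"
    and xs: "xs \<noteq> []" "\<And>x. x \<in> set xs \<Longrightarrow> 0 < x"
    and Z: "s \<le> t" "t \<le> Z"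
    and total: "sum_list xs + Z = real (length xs) * s + t"
  shows "real (length xs) * f s + f t \<le> sum_list (map f xs) + f Z"
proof -
  define n where "n = length xs"
  define m where "m = sum_list xs / real n"
  have n: "0 < real n" using xs by (simp add: n_def)
  have sum_xs: "sum_list xs = real n * m" using n by (simp add: m_def)
  have "real n * m \<le> real n * s" using total sum_xs Z by (simp add: n_def)
  then have ms: "m \<le> s" using n by simp
  have idx: "sum_list (map g xs) = (\<Sum>i<n. g (xs ! i))" for g :: "real \<Rightarrow> real"
    by (simp add: n_def sum_list_sum_nth atLeast0LessThan)
  have "0 < sum_list xs"
    using idx[of "\<lambda>x. x"] n xs by (auto simp: n_def intro!: sum_pos)
  then have m: "0 < m" using n by (simp add: m_def)
  have "f (\<Sum>i<n. (1 / real n) *\<^sub>R xs ! i) \<le> (\<Sum>i<n. (1 / real n) * f (xs ! i))"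
    using n xs by (intro convex_on_sum[OF _ _ f]) (auto simp: n_def)
  then have "f m \<le> sum_list (map f xs) / real n"
    using idx[of "\<lambda>x. x"] idx[of f] by (simp add: m_def sum_divide_distrib)
  then have jensen: "real n * f m \<le> sum_list (map f xs)"
    using n by (simp add: field_simps)
  have sub: "convex_on {m..Z} f"
    by (rule convex_on_subset[OF f]) (use m in auto)
  \<comment> \<open>equal totals, measured from \<open>m\<close>: this is where the affine chord sees no difference\<close>
  have total': "real n * (s - m) + (t - m) = Z - m"
    using total sum_xs by (simp add: n_def algebra_simps)
  have "real n * f s + f t \<le> real n * f m + f Z"
  proof (cases "m = Z")
    case True
    then have "s = m" "t = m" using ms Z by auto
    then show ?thesis using True by simp
  next
    case False
    define c where "c = (f Z - f m) / (Z - m)"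
    have c: "c * (Z - m) = f Z - f m" using False by (simp add: c_def)
    have chord: "f x \<le> c * (x - m) + f m" if "x \<in> {m..Z}" for x
      using convex_onD_Icc'[OF sub that] by (simp add: c_def)
    have "real n * f s + f t \<le> real n * (c * (s - m) + f m) + (c * (t - m) + f m)"
      using chord[of s] chord[of t] ms Z n by (intro add_mono mult_left_mono) auto
    also have "\<dots> = c * (real n * (s - m) + (t - m)) + real n * f m + f m"
      by (simp add: algebra_simps)
    also have "\<dots> = real n * f m + f Z"
      unfolding total' c by simp
    finally show ?thesis .
  qed
  then show ?thesis using jensen by (simp add: n_def)
qed

text \<open>
  Strictness. The difference of the two sums of squares is the squared distance between the lists
  plus \<open>2 (Z - t) (t - s)\<close>, which is nonnegative.
\<close>

lemma sum_squares_strictly_below_spread_list: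
  fixes s t Z :: real
  assumes Z: "s \<le> t" "t \<le> Z"
    and total: "sum_list xs + Z = real (length xs) * s + t"
    and neq: "xs @ [Z] \<noteq> replicate (length xs) s @ [t]"
  shows "real (length xs) * s\<^sup>2 + t\<^sup>2 < (\<Sum>x\<leftarrow>xs. x\<^sup>2) + Z\<^sup>2"
proof -
  have expand: "(\<Sum>x\<leftarrow>xs. (x - s)\<^sup>2) = (\<Sum>x\<leftarrow>xs. x\<^sup>2) - 2 * s * sum_list xs + real (length xs) * s\<^sup>2"
    by (induction xs) (auto simp: power2_eq_square algebra_simps)
  have sum_xs: "sum_list xs = real (length xs) * s + t - Z" using total by simp
  have "(\<Sum>x\<leftarrow>xs. x\<^sup>2) + Z\<^sup>2 - (real (length xs) * s\<^sup>2 + t\<^sup>2)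
      = (\<Sum>x\<leftarrow>xs. (x - s)\<^sup>2) + (Z - t)\<^sup>2 + 2 * ((Z - t) * (t - s))"
    unfolding expand sum_xs by (simp add: power2_eq_square algebra_simps)
  moreover have "0 \<le> (Z - t) * (t - s)" using Z by simp
  moreover have "0 < (\<Sum>x\<leftarrow>xs. (x - s)\<^sup>2) + (Z - t)\<^sup>2"
  proof (cases "Z = t")
    case True
    with neq have "\<exists>x\<in>set xs. x \<noteq> s" by (metis replicate_eqI)
    then obtain x where x: "x \<in> set xs" "x \<noteq> s" by blast
    have "(x - s)\<^sup>2 \<le> (\<Sum>x\<leftarrow>xs. (x - s)\<^sup>2)"
      by (rule member_le_sum_list) (use x in auto)
    moreover have "0 < (x - s)\<^sup>2" using x by simp
    ultimately show ?thesis using zero_le_power2[of "Z - t"] by linarith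
  next
    case False
    then have "0 < (Z - t)\<^sup>2" by simp
    moreover have "0 \<le> (\<Sum>x\<leftarrow>xs. (x - s)\<^sup>2)" by (rule sum_list_nonneg) auto
    ultimately show ?thesis by linarith
  qed
  ultimately show ?thesis by linarith
qed

section \<open>The criteria as functions of the free eigenvalues\<close>

text \<open>
  The list \<open>es\<close> enumerates the eigenvalues that depend on the design. The remaining eigenvalues
  are the \<open>0\<close> of the constant vector and \<open>v - 1 - r\<close> forced copies of \<open>r\<close>; the latter come last
  in the sorted list of nonzero eigenvalues, so that \<open>es\<close> occupies the indices \<open>1, \<dots>, r\<close>.
\<close>

definition free_spectrum :: "nat \<Rightarrow> nat \<Rightarrow> nat \<Rightarrow> nat \<Rightarrow> design \<Rightarrow> real list \<Rightarrow> bool" where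
  "free_spectrum v r k1 k2 d es \<longleftrightarrow>
     sorted es \<and> length es = r \<and> (\<forall>e\<in>set es. 0 < e \<and> e \<le> real r) \<and> sum_list es = real r * (real r - 1) \<and>
     eigenvalue_mset (information_mat v r k1 k2 d) =
       add_mset 0 (replicate_mset (v - 1 - r) (real r) + mset es)"

lemma z_eq_nth:
  assumes "free_spectrum v r k1 k2 d es" and "0 < r"
  shows "z v r k1 k2 d i = (es @ replicate (v - 1 - r) (real r)) ! (i - 1)"
proof -
  let ?zs = "es @ replicate (v - 1 - r) (real r)"
  have "filter_mset (\<lambda>x. x \<noteq> 0) (mset ?zs) = mset ?zs"
    unfolding filter_mset_eq_conv using assms by (auto simp: free_spectrum_def)
  moreover have "eigenvalue_mset (information_mat v r k1 k2 d) = add_mset 0 (mset ?zs)"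
    using assms by (simp add: free_spectrum_def)
  ultimately have "filter_mset (\<lambda>x. x \<noteq> 0) (eigenvalue_mset (information_mat v r k1 k2 d)) = mset ?zs"
    by simp
  moreover have "sorted ?zs"
    using assms by (auto simp: free_spectrum_def sorted_append)
  ultimately show ?thesis
    unfolding z_def by (simp only: sorted_list_of_multiset_mset sorted_sort_id)
qed

lemma psi_eq_free_spectrum:
  assumes "free_spectrum v r k1 k2 d es" and "0 < r" and "r \<le> v - 1"
  shows "psi v r k1 k2 f d = sum_list (map f es) + real (v - 1 - r) * f (real r)"
proof -
  let ?zs = "es @ replicate (v - 1 - r) (real r)"
  have len: "length ?zs = v - 1" using assms by (simp add: free_spectrum_def)
  have "psi v r k1 k2 f d = (\<Sum>i = 1..v - 1. f (?zs ! (i - 1)))"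
    unfolding psi_def z_eq_nth[OF assms(1,2)] ..
  also have "\<dots> = (\<Sum>i<v - 1. f (?zs ! i))"
    by (rule sum.reindex_bij_witness[of _ Suc "\<lambda>i. i - 1"]) auto
  also have "\<dots> = sum_list (map f ?zs)"
    using len by (simp add: sum_list_sum_nth atLeast0LessThan del: map_append length_append)
  also have "\<dots> = sum_list (map f es) + real (v - 1 - r) * f (real r)"
    by (simp add: sum_list_replicate)
  finally show ?thesis .
qed

lemma psi_F_eq_last:
  assumes "free_spectrum v r k1 k2 d es" and "0 < r"
  shows "psi_F v r k1 k2 d = last es"
  using assms unfolding psi_F_def z_eq_nth[OF assms]
  by (auto simp: free_spectrum_def nth_append last_conv_nth)

text \<open>
  The heart of the theorem: against a design whose free eigenvalues are all equal except for one that is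
  at least as large, comparing every convex criterion amounts to comparing the largest free eigenvalue.
\<close>

lemma psi_le_iff_psi_F_le:
  assumes bar: "free_spectrum v r k1 k2 dbar (replicate (r - 1) s @ [t])" and d: "free_spectrum v r k1 k2 d es"
    and r: "2 \<le> r" "r \<le> v - 1"
  shows "(\<forall>f. convex_on {0<..} f \<longrightarrow> psi v r k1 k2 f dbar \<le> psi v r k1 k2 f d) \<longleftrightarrow>
    psi_F v r k1 k2 dbar \<le> psi_F v r k1 k2 d"
proof
  define xs Z where "xs = butlast es" and "Z = last es"
  have es: "es = xs @ [Z]"
    unfolding xs_def Z_def by (rule append_butlast_last_id[symmetric]) (use d r in \<open>auto simp: free_spectrum_def\<close>)
  have F: "psi_F v r k1 k2 dbar = t" "psi_F v r k1 k2 d = Z"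
    using psi_F_eq_last[OF bar] psi_F_eq_last[OF d] r by (auto simp: Z_def)
  have len: "length xs = r - 1" and pos: "\<And>x. x \<in> set xs \<Longrightarrow> 0 < x" and le: "\<And>x. x \<in> set xs \<Longrightarrow> x \<le> Z"
    using d by (auto simp: free_spectrum_def es sorted_append)
  have "0 < r" using r by simp
  note psi = psi_eq_free_spectrum[OF bar this r(2)] psi_eq_free_spectrum[OF d this r(2)]
  {
    assume *: "\<forall>f. convex_on {0<..} f \<longrightarrow> psi v r k1 k2 f dbar \<le> psi v r k1 k2 f d"
    \<comment> \<open>a convex function that sees only eigenvalues above all free eigenvalues of \<open>d\<close>\<close>
    let ?f = "\<lambda>x. max 0 (x - Z)"
    have "convex_on {0<..} ?f"
    proof (rule convex_onI)
      fix c x y :: real assume c: "0 < c" "c < 1"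
      have "(1 - c) * (x - Z) \<le> (1 - c) * ?f x" and "c * (y - Z) \<le> c * ?f y"
        using c by (auto intro: mult_left_mono)
      then have "(1 - c) * x + c * y - Z \<le> (1 - c) * ?f x + c * ?f y"
        by (simp add: algebra_simps)
      moreover have "0 \<le> (1 - c) * ?f x + c * ?f y" using c by simp
      ultimately show "?f ((1 - c) *\<^sub>R x + c *\<^sub>R y) \<le> (1 - c) * ?f x + c * ?f y" by simp
    qed simp
    with * have "psi v r k1 k2 ?f dbar \<le> psi v r k1 k2 ?f d" by blast
    then have "real (r - 1) * ?f s + ?f t \<le> sum_list (map ?f xs) + ?f Z"
      unfolding psi es by (simp add: sum_list_replicate)
    also have "sum_list (map ?f xs) = sum_list (map (\<lambda>x. 0) xs)"
      using le by (intro arg_cong[of _ _ sum_list] map_cong) auto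
    also have "\<dots> + ?f Z = 0" by simp
    finally have "?f t \<le> 0" by (smt (verit) mult_nonneg_nonneg of_nat_0_le_iff)
    then show "psi_F v r k1 k2 dbar \<le> psi_F v r k1 k2 d" unfolding F by simp
  next
    assume "psi_F v r k1 k2 dbar \<le> psi_F v r k1 k2 d"
    then have tZ: "t \<le> Z" unfolding F .
    have st: "s \<le> t" using bar r by (auto simp: free_spectrum_def sorted_append)
    have "sum_list xs + Z = real (length xs) * s + t"
      using bar d by (simp add: free_spectrum_def es sum_list_replicate len)
    moreover have "xs \<noteq> []" using len r by auto
    ultimately have "real (length xs) * f s + f t \<le> sum_list (map f xs) + f Z"
      if "convex_on {0<..} f" for f
      using convex_sum_below_spread_list[OF that _ pos st tZ] by blast
    then show "\<forall>f. convex_on {0<..} f \<longrightarrow> psi v r k1 k2 f dbar \<le> psi v r k1 k2 f d"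
      unfolding psi es using len by (simp add: sum_list_replicate)
  }
qed

lemma psi_square_less:
  assumes bar: "free_spectrum v r k1 k2 dbar (replicate (r - 1) s @ [t])" and d: "free_spectrum v r k1 k2 d es"
    and r: "2 \<le> r" "r \<le> v - 1" and F: "psi_F v r k1 k2 dbar \<le> psi_F v r k1 k2 d"
    and neq: "eigenvalue_mset (information_mat v r k1 k2 d) \<noteq> eigenvalue_mset (information_mat v r k1 k2 dbar)"
  shows "psi v r k1 k2 (\<lambda>x. x\<^sup>2) dbar < psi v r k1 k2 (\<lambda>x. x\<^sup>2) d"
proof -
  define xs Z where "xs = butlast es" and "Z = last es"
  have es: "es = xs @ [Z]"
    unfolding xs_def Z_def by (rule append_butlast_last_id[symmetric]) (use d r in \<open>auto simp: free_spectrum_def\<close>)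
  have r0: "0 < r" using r by simp
  have len: "length xs = r - 1"
    using d by (auto simp: free_spectrum_def es)
  have tZ: "t \<le> Z" using F psi_F_eq_last[OF bar] psi_F_eq_last[OF d] r by (auto simp: Z_def)
  have st: "s \<le> t" using bar r by (auto simp: free_spectrum_def sorted_append)
  have total: "sum_list xs + Z = real (length xs) * s + t"
    using bar d by (simp add: free_spectrum_def es sum_list_replicate len)
  have "es \<noteq> replicate (r - 1) s @ [t]"
    using neq bar d unfolding free_spectrum_def by metis
  then have "xs @ [Z] \<noteq> replicate (length xs) s @ [t]" unfolding es len .
  from sum_squares_strictly_below_spread_list[OF st tZ total this]
  show ?thesis
    unfolding psi_eq_free_spectrum[OF bar r0 r(2)] psi_eq_free_spectrum[OF d r0 r(2)]
    by (simp add: es len sum_list_replicate)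
qed

section \<open>The spectrum of the information matrix\<close>

lemma sum_even_odd_pairs:
  fixes g :: "nat \<Rightarrow> 'a :: comm_monoid_add"
  shows "(\<Sum>c<2 * r. g c) = (\<Sum>h<r. g (2 * h) + g (2 * h + 1))"
  by (induction r) (auto simp: add.assoc)

lemma sum_centred_indicator_products:
  fixes A B :: "nat set"
  assumes "A \<subseteq> {..<v}" and "B \<subseteq> {..<v}"
  shows "(\<Sum>i<v. ((if i \<in> A then 1 else 0) - a) * ((if i \<in> B then 1 else 0) - b)) =
    real (card (A \<inter> B)) - b * real (card A) - a * real (card B) + real v * (a * b)"
proof -
  have card: "(\<Sum>i<v. if i \<in> S then 1 else 0) = real (card S)" if "S \<subseteq> {..<v}" for S
    using that by (simp add: sum.If_cases Int_absorb1)
  have "((if i \<in> A then 1 else 0) - a) * ((if i \<in> B then 1 else 0) - b) =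
     (if i \<in> A \<inter> B then 1 else 0) - b * (if i \<in> A then 1 else 0) - a * (if i \<in> B then 1 else 0) + a * b" for i
    by (auto simp: algebra_simps)
  then have "(\<Sum>i<v. ((if i \<in> A then 1 else 0) - a) * ((if i \<in> B then 1 else 0) - b)) =
     (\<Sum>i<v. if i \<in> A \<inter> B then 1 else 0) - b * (\<Sum>i<v. if i \<in> A then 1 else 0)
       - a * (\<Sum>i<v. if i \<in> B then 1 else 0) + real v * (a * b)"
    by (simp only: sum.distrib sum_subtractf sum_distrib_left) simp
  also have "\<dots> = real (card (A \<inter> B)) - b * real (card A) - a * real (card B) + real v * (a * b)"
    using assms by (simp only: card inf.coboundedI1)
  finally show ?thesis .
qed

text \<open>
  The left side is an entry of the projection onto the indicators of two complementary blocks of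
  sizes \<open>p\<close> and \<open>q\<close>, with \<open>x\<close>, \<open>y\<close> the indicator values of the first block; the right side is
  the same entry in the orthogonal basis formed by the constant vector and the centred indicator.
\<close>

lemma two_block_projection_identity:
  fixes p q x y :: real
  assumes "0 < p" and "0 < q"
  shows "x * y / p + (1 - x) * (1 - y) / q =
    1 / (p + q) + (x - p / (p + q)) * (y - p / (p + q)) / (p * q / (p + q))"
proof -
  have s: "p + q \<noteq> 0" using assms by simp
  have "(x - p / (p + q)) * (y - p / (p + q)) / (p * q / (p + q)) =
    ((p + q) * x - p) * ((p + q) * y - p) / ((p + q) * (p * q))"
  proof -
    have "x - p / (p + q) = ((p + q) * x - p) / (p + q)" "y - p / (p + q) = ((p + q) * y - p) / (p + q)"
      using s by (simp_all add: diff_divide_distrib)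
    then show ?thesis using s by simp
  qed
  moreover have "x * y / p + (1 - x) * (1 - y) / q =
    (x * y * q + (1 - x) * (1 - y) * p) * (p + q) / ((p + q) * (p * q))"
    using s assms by (simp add: add_divide_distrib)
  moreover have "1 / (p + q) = p * q / ((p + q) * (p * q))" using assms by simp
  moreover have "(x * y * q + (1 - x) * (1 - y) * p) * (p + q) =
    p * q + ((p + q) * x - p) * ((p + q) * y - p)"
    by (simp add: algebra_simps)
  ultimately show ?thesis by (simp add: add_divide_distrib)
qed

locale two_block_design =
  fixes v r k1 k2 :: nat and d :: design
  assumes v: "v = k1 + k2" and k: "0 < k1" "0 < k2"
    and res: "resolvable_design v r k1 k2 d"
begin

definition centred :: "nat \<Rightarrow> nat \<Rightarrow> real" where
  "centred h i = (if i \<in> fst (d ! h) then 1 else 0) - real k1 / real v"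

text \<open>The common squared norm of the centred block indicators; see lemma \<open>gram_diag\<close>.\<close>

definition sqnorm :: real where "sqnorm = real k1 * real k2 / real v"

definition gram :: "nat \<Rightarrow> nat \<Rightarrow> real" where
  "gram h h' = (\<Sum>i<v. centred h i * centred h' i)"

text \<open>
  In terms of the matrix \<open>M\<close> of deviations of the concurrences from \<open>k1\<^sup>2 / v\<close>, which is the Gram
  matrix here, this is \<open>r I - (v / (k1 k2)) M\<close>. Its eigenvalues are the free eigenvalues of the design.
\<close>

definition reduced_mat :: "real mat" where
  "reduced_mat = mat r r (\<lambda>(h, h'). (if h = h' then real r else 0) - gram h h' / sqnorm)"

lemma reduced_mat_carrier [simp]: "reduced_mat \<in> carrier_mat r r"
  by (simp add: reduced_mat_def)

lemma v_pos: "0 < real v"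
  using v k by simp

lemma sqnorm_pos: "0 < sqnorm"
  using v_pos k by (simp add: sqnorm_def)

lemma block_facts:
  assumes "h < r"
  shows "fst (d ! h) \<subseteq> {..<v}" "card (fst (d ! h)) = k1"
    "i < v \<Longrightarrow> i \<in> snd (d ! h) \<longleftrightarrow> i \<notin> fst (d ! h)"
  using res assms unfolding resolvable_design_def is_replicate_def by blast+

lemma sum_centred: "h < r \<Longrightarrow> (\<Sum>i<v. centred h i) = 0"
  using block_facts(1,2)[of h] v_pos
  by (simp add: centred_def sum_subtractf sum.If_cases Int_absorb1)

lemma gram_eq:
  assumes "h < r" and "h' < r"
  shows "gram h h' = real (phi d h h') - (real k1)\<^sup>2 / real v"
  unfolding gram_def centred_def sum_centred_indicator_products[OF block_facts(1)[OF assms(1)] block_facts(1)[OF assms(2)]]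
    block_facts(2)[OF assms(1)] block_facts(2)[OF assms(2)] phi_def
  using v_pos by (simp add: field_simps power2_eq_square)

lemma gram_diag: "h < r \<Longrightarrow> gram h h = sqnorm"
  using v_pos block_facts(2)[of h]
  by (simp add: gram_eq phi_def sqnorm_def divide_simps) (simp add: v power2_eq_square algebra_simps)

lemma gram_sym: "gram h h' = gram h' h"
  by (simp add: gram_def mult.commute)

lemma concurrence_identity:
  assumes "h < r" "i < v" "j < v"
  shows "(if i \<in> fst (d ! h) then 1 else 0) * (if j \<in> fst (d ! h) then 1 else 0) / real k1 +
    (if i \<in> snd (d ! h) then 1 else 0) * (if j \<in> snd (d ! h) then 1 else 0) / real k2 =
    1 / real v + centred h i * centred h j / sqnorm"
proof -
  define x y where "x = (if i \<in> fst (d ! h) then 1 else 0 :: real)" and "y = (if j \<in> fst (d ! h) then 1 else 0 :: real)"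
  \<comment> \<open>the second block is the complement of the first, so its indicator is one minus that of the first\<close>
  have xy: "(if i \<in> snd (d ! h) then 1 else 0) = 1 - x" "(if j \<in> snd (d ! h) then 1 else 0) = 1 - y"
    using block_facts(3)[OF assms(1)] assms(2,3) by (auto simp: x_def y_def)
  show ?thesis
    using two_block_projection_identity[of "real k1" "real k2" x y] k
    unfolding xy centred_def sqnorm_def x_def[symmetric] y_def[symmetric] using v by simp
qed

text \<open>
  Two factors whose product is \<open>r I\<close> minus the information matrix. The inner index \<open>0\<close> belongs to the
  constant vector, the inner index \<open>h + 1\<close> to replicate \<open>h\<close>.
\<close>

definition contrast_mat :: "real mat" where
  "contrast_mat = mat v (1 + r) (\<lambda>(i, c). if c = 0 then 1 else centred (c - 1) i)"

definition weight_mat :: "real mat" where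
  "weight_mat = mat (1 + r) v (\<lambda>(c, i). if c = 0 then real r / real v else centred (c - 1) i / sqnorm)"

lemma contrast_mat_carrier [simp]: "contrast_mat \<in> carrier_mat v (1 + r)"
  and weight_mat_carrier [simp]: "weight_mat \<in> carrier_mat (1 + r) v"
  by (simp_all add: contrast_mat_def weight_mat_def)

lemma concurrence_index:
  assumes "i < v" "j < v"
  shows "(contrast_mat * weight_mat) $$ (i, j) = real r / real v + (\<Sum>h<r. centred h i * centred h j / sqnorm)"
proof -
  have "(contrast_mat * weight_mat) $$ (i, j) = (\<Sum>c<Suc r. contrast_mat $$ (i, c) * weight_mat $$ (c, j))"
    using assms by (simp add: contrast_mat_def weight_mat_def scalar_prod_def atLeast0LessThan)
  also have "\<dots> = real r / real v + (\<Sum>h<r. centred h i * centred h j / sqnorm)"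
    using assms by (subst sum.lessThan_Suc_shift) (simp add: contrast_mat_def weight_mat_def)
  finally show ?thesis .
qed

lemma information_mat_eq: "information_mat v r k1 k2 d = real r \<cdot>\<^sub>m 1\<^sub>m v - contrast_mat * weight_mat"
proof -
  let ?N = "incidence_mat v r d"
  let ?w = "\<lambda>c. if even c then 1 / real k1 else 1 / real k2"
  have N: "?N \<in> carrier_mat v (2 * r)" by (simp add: incidence_mat_def)
  have ND: "?N * mat_diag (2 * r) ?w = mat v (2 * r) (\<lambda>(i, c). ?N $$ (i, c) * ?w c)"
    by (rule mat_diag_mult_right[OF N])
  have "?N * mat_diag (2 * r) ?w * transpose_mat ?N = contrast_mat * weight_mat"
  proof (rule eq_matI)
    fix i j assume "i < dim_row (contrast_mat * weight_mat)" "j < dim_col (contrast_mat * weight_mat)"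
    then have i: "i < v" and j: "j < v" by (auto simp: contrast_mat_def weight_mat_def)
    have "(?N * mat_diag (2 * r) ?w * transpose_mat ?N) $$ (i, j) =
        (\<Sum>c<2 * r. ?N $$ (i, c) * ?w c * ?N $$ (j, c))"
      unfolding ND using i j N by (simp add: scalar_prod_def atLeast0LessThan)
    also have "\<dots> = (\<Sum>c<2 * r. (if i \<in> block d c then 1 else 0) * ?w c * (if j \<in> block d c then 1 else 0))"
      using i j by (intro sum.cong) (auto simp: incidence_mat_def)
    also have "\<dots> = (\<Sum>h<r. 1 / real v + centred h i * centred h j / sqnorm)"
      unfolding sum_even_odd_pairs
    proof (rule sum.cong[OF refl])
      fix h assume "h \<in> {..<r}"
      then show "(if i \<in> block d (2 * h) then 1 else 0) * ?w (2 * h) * (if j \<in> block d (2 * h) then 1 else 0) +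
        (if i \<in> block d (2 * h + 1) then 1 else 0) * ?w (2 * h + 1) * (if j \<in> block d (2 * h + 1) then 1 else 0)
        = 1 / real v + centred h i * centred h j / sqnorm"
        using concurrence_identity[of h i j] i j by (simp add: block_def cong: if_cong)
    qed
    also have "\<dots> = (contrast_mat * weight_mat) $$ (i, j)"
      unfolding concurrence_index[OF i j] by (simp add: sum.distrib)
    finally show "(?N * mat_diag (2 * r) ?w * transpose_mat ?N) $$ (i, j) = (contrast_mat * weight_mat) $$ (i, j)" .
  qed (auto simp: incidence_mat_def contrast_mat_def weight_mat_def)
  then show ?thesis
    unfolding information_mat_def block_size_mat_inverse[OF k] by simp
qed

text \<open>
  Centred indicators are orthogonal to the constant vector, so in the reversed product the constant
  vector splits off as a block of its own. Its entry \<open>r - r = 0\<close> is the zero eigenvalue of the information matrix.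
\<close>

lemma reduced_block_form:
  "real r \<cdot>\<^sub>m 1\<^sub>m (1 + r) - weight_mat * contrast_mat = four_block_mat (0\<^sub>m 1 1) (0\<^sub>m 1 r) (0\<^sub>m r 1) reduced_mat" (is "?L = ?R")
proof (rule eq_matI)
  fix c c' assume "c < dim_row ?R" "c' < dim_col ?R"
  then have c: "c < 1 + r" "c' < 1 + r" by (auto simp: reduced_mat_def)
  have "(weight_mat * contrast_mat) $$ (c, c') = (\<Sum>i<v. weight_mat $$ (c, i) * contrast_mat $$ (i, c'))"
    using c by (simp add: contrast_mat_def weight_mat_def scalar_prod_def atLeast0LessThan)
  also have "\<dots> = (\<Sum>i<v. (if c = 0 then real r / real v else centred (c - 1) i / sqnorm) * (if c' = 0 then 1 else centred (c' - 1) i))"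
    using c by (intro sum.cong) (auto simp: contrast_mat_def weight_mat_def)
  also have "\<dots> = (if c = 0 then if c' = 0 then real r else 0 else if c' = 0 then 0 else gram (c - 1) (c' - 1) / sqnorm)"
    using c sum_centred[of "c - 1"] sum_centred[of "c' - 1"] v_pos
    by (cases "c = 0"; cases "c' = 0")
      (simp_all add: gram_def sum_distrib_left[symmetric] sum_divide_distrib[symmetric])
  finally show "?L $$ (c, c') = ?R $$ (c, c')"
    using c by (auto simp: reduced_mat_def contrast_mat_def weight_mat_def)
qed (auto simp: contrast_mat_def weight_mat_def reduced_mat_def)

lemma char_poly_information_mat:
  assumes "r \<le> v - 1"
  shows "char_poly (information_mat v r k1 k2 d) = [:- real r, 1:] ^ (v - 1 - r) * ([:0, 1:] * char_poly reduced_mat)"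
proof -
  have "char_poly (real r \<cdot>\<^sub>m 1\<^sub>m (1 + r) - weight_mat * contrast_mat) = char_poly (0\<^sub>m 1 1) * char_poly reduced_mat"
    unfolding reduced_block_form by (rule char_poly_four_block_zeros_col) auto
  also have "char_poly (0\<^sub>m 1 1 :: real mat) = [:0, 1:]"
    by (simp add: char_poly_defs det_single)
  finally have block: "char_poly (real r \<cdot>\<^sub>m 1\<^sub>m (1 + r) - weight_mat * contrast_mat) = [:0, 1:] * char_poly reduced_mat" .
  \<comment> \<open>the swap introduces powers of \<open>x - r\<close> with exponents \<open>1 + r\<close> and \<open>v\<close>; the excess is the forced multiplicity\<close>
  have "v = (1 + r) + (v - 1 - r)" using assms v k by simp
  then have "[:- real r, 1:] ^ v = [:- real r, 1:] ^ (1 + r) * [:- real r, 1:] ^ (v - 1 - r)"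
    by (metis power_add)
  with char_poly_swap_product[OF contrast_mat_carrier weight_mat_carrier, of "real r"]
  have "[:- real r, 1:] ^ (1 + r) * char_poly (information_mat v r k1 k2 d) =
      [:- real r, 1:] ^ (1 + r) * ([:- real r, 1:] ^ (v - 1 - r) * ([:0, 1:] * char_poly reduced_mat))"
    unfolding information_mat_eq block by (simp only: mult.assoc)
  moreover have "[:- real r, 1:] ^ (1 + r) \<noteq> 0" by (rule power_not_zero) simp
  ultimately show ?thesis by (metis mult_left_cancel)
qed

lemma eigenvalue_mset_information_mat:
  assumes "r \<le> v - 1"
  shows "eigenvalue_mset (information_mat v r k1 k2 d) =
    add_mset 0 (replicate_mset (v - 1 - r) (real r) + eigenvalue_mset reduced_mat)"
proof -
  have "char_poly reduced_mat \<noteq> 0"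
    using degree_monic_char_poly[OF reduced_mat_carrier] by auto
  moreover have "[:- real r, 1:] ^ (v - 1 - r) \<noteq> 0" by simp
  ultimately show ?thesis
    unfolding eigenvalue_mset_def char_poly_information_mat[OF assms]
    by (subst proots_mult, simp, simp, subst proots_mult) (auto simp: proots_power repeat_mset_single)
qed

lemma reduced_mat_eigenvector:
  assumes "poly (char_poly reduced_mat) e = 0"
  obtains w where "\<forall>h<r. (\<Sum>h'<r. gram h h' * w h') = sqnorm * (real r - e) * w h"
    "0 < (\<Sum>h<r. (w h)\<^sup>2)"
proof -
  have "eigenvalue reduced_mat e" using assms eigenvalue_root_char_poly[OF reduced_mat_carrier] by simp
  then obtain x where x: "x \<in> carrier_vec r" "x \<noteq> 0\<^sub>v r" "reduced_mat *\<^sub>v x = e \<cdot>\<^sub>v x"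
    unfolding eigenvalue_def eigenvector_def by (auto simp: reduced_mat_def)
  show ?thesis
  proof (rule that[of "\<lambda>h. x $ h"], intro allI impI)
    fix h assume h: "h < r"
    have "e * x $ h = (reduced_mat *\<^sub>v x) $ h" using x h by simp
    also have "\<dots> = (\<Sum>h'<r. reduced_mat $$ (h, h') * x $ h')"
      using h x(1) by (simp add: reduced_mat_def scalar_prod_def atLeast0LessThan)
    also have "\<dots> = (\<Sum>h'<r. (if h' = h then real r * x $ h' else 0) - gram h h' * x $ h' / sqnorm)"
      using h by (intro sum.cong) (auto simp: reduced_mat_def algebra_simps)
    also have "\<dots> = real r * x $ h - (\<Sum>h'<r. gram h h' * x $ h') / sqnorm"
      using h by (simp add: sum_subtractf sum_divide_distrib)
    finally show "(\<Sum>h'<r. gram h h' * x $ h') = sqnorm * (real r - e) * x $ h"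
      using sqnorm_pos by (simp add: field_simps)
  next
    obtain h where "h < r" "x $ h \<noteq> 0"
      using x by (metis carrier_vecD eq_vecI index_zero_vec)
    then show "0 < (\<Sum>h<r. (x $ h)\<^sup>2)"
      by (intro sum_pos2[of _ h]) auto
  qed
qed

text \<open>For an eigenvector \<open>w\<close> of the Gram matrix \<open>U' U\<close>, this is \<open>|U w|\<^sup>2 = w \<bullet> (U' U w)\<close>.\<close>

lemma gram_quadratic_form:
  assumes "\<And>h. h < r \<Longrightarrow> (\<Sum>h'<r. gram h h' * w h') = c * w h"
  shows "(\<Sum>i<v. (\<Sum>h<r. centred h i * w h)\<^sup>2) = c * (\<Sum>h<r. (w h)\<^sup>2)"
proof -
  have "(\<Sum>i<v. (\<Sum>h<r. centred h i * w h)\<^sup>2) = (\<Sum>i<v. \<Sum>h<r. \<Sum>h'<r. w h * (centred h i * centred h' i * w h'))"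
    by (simp add: power2_eq_square sum_product mult_ac)
  also have "\<dots> = (\<Sum>h<r. \<Sum>h'<r. \<Sum>i<v. w h * (centred h i * centred h' i * w h'))"
    by (subst sum.swap, rule sum.cong[OF refl], rule sum.swap)
  also have "\<dots> = (\<Sum>h<r. w h * (\<Sum>h'<r. gram h h' * w h'))"
    by (simp add: gram_def sum_distrib_left sum_distrib_right)
  also have "\<dots> = c * (\<Sum>h<r. (w h)\<^sup>2)"
    using assms by (simp add: sum_distrib_left power2_eq_square mult_ac)
  finally show ?thesis .
qed

text \<open>
  The corresponding eigenvalue \<open>sqnorm * (r - e)\<close> of the Gram matrix is nonnegative, since it is
  \<open>|U w|\<^sup>2 / |w|\<^sup>2\<close>, and at most \<open>r * sqnorm\<close>, by the Cauchy-Schwarz inequality applied to each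
  coordinate of \<open>U w\<close>.
\<close>

lemma reduced_mat_eigenvalue_bounds:
  assumes "poly (char_poly reduced_mat) e = 0"
  shows "0 \<le> e" "e \<le> real r"
proof -
  obtain w where w: "\<forall>h<r. (\<Sum>h'<r. gram h h' * w h') = sqnorm * (real r - e) * w h"
    and pos: "0 < (\<Sum>h<r. (w h)\<^sup>2)"
    by (rule reduced_mat_eigenvector[OF assms])
  have q: "(\<Sum>i<v. (\<Sum>h<r. centred h i * w h)\<^sup>2) = sqnorm * (real r - e) * (\<Sum>h<r. (w h)\<^sup>2)"
    by (rule gram_quadratic_form) (use w in blast)
  have "0 \<le> sqnorm * (real r - e) * (\<Sum>h<r. (w h)\<^sup>2)"
    unfolding q[symmetric] by (rule sum_nonneg) simp
  then show "e \<le> real r" using pos sqnorm_pos by (simp add: zero_le_mult_iff)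
  have "(\<Sum>i<v. (\<Sum>h<r. centred h i * w h)\<^sup>2) \<le> (\<Sum>i<v. real r * (\<Sum>h<r. (centred h i * w h)\<^sup>2))"
  proof (rule sum_mono)
    fix i show "(\<Sum>h<r. centred h i * w h)\<^sup>2 \<le> real r * (\<Sum>h<r. (centred h i * w h)\<^sup>2)"
      using sum_squared_le_sum_of_squares[of "\<lambda>h. centred h i * w h" "{..<r}"] by (simp add: mult.commute)
  qed
  also have "\<dots> = real r * (\<Sum>h<r. gram h h * (w h)\<^sup>2)"
    unfolding sum_distrib_left[symmetric] gram_def
    by (subst sum.swap) (simp add: sum_distrib_left power2_eq_square mult_ac)
  also have "\<dots> = sqnorm * real r * (\<Sum>h<r. (w h)\<^sup>2)"
    by (simp add: gram_diag sum_distrib_left mult_ac)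
  finally have "sqnorm * (real r - e) * (\<Sum>h<r. (w h)\<^sup>2) \<le> sqnorm * real r * (\<Sum>h<r. (w h)\<^sup>2)"
    unfolding q .
  then show "0 \<le> e" using pos sqnorm_pos by (simp add: mult_le_cancel_left)
qed

lemma information_mat_mult_vec:
  assumes "i < v"
  shows "(information_mat v r k1 k2 d *\<^sub>v vec v x) $ i =
    real r * x i - real r / real v * (\<Sum>j<v. x j) - (\<Sum>h<r. centred h i * (\<Sum>j<v. centred h j * x j)) / sqnorm"
proof -
  have "(information_mat v r k1 k2 d *\<^sub>v vec v x) $ i =
      (\<Sum>j<v. (if j = i then real r * x j else 0) - (contrast_mat * weight_mat) $$ (i, j) * x j)"
    unfolding information_mat_eq using assms
    by (auto simp: scalar_prod_def atLeast0LessThan contrast_mat_def weight_mat_def algebra_simps intro!: sum.cong)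
  also have "\<dots> = real r * x i - (\<Sum>j<v. (contrast_mat * weight_mat) $$ (i, j) * x j)"
    using assms by (simp add: sum_subtractf)
  also have "(\<Sum>j<v. (contrast_mat * weight_mat) $$ (i, j) * x j) =
      (\<Sum>j<v. real r / real v * x j + (\<Sum>h<r. centred h i * (centred h j * x j)) / sqnorm)"
    using assms by (intro sum.cong) (auto simp: concurrence_index algebra_simps sum_distrib_left sum_distrib_right sum_divide_distrib)
  also have "\<dots> = real r / real v * (\<Sum>j<v. x j) + (\<Sum>h<r. centred h i * (\<Sum>j<v. centred h j * x j)) / sqnorm"
    unfolding sum.distrib sum_divide_distrib[symmetric] sum_distrib_left[symmetric]
    by (subst sum.swap) (simp add: sum_distrib_left)
  finally show ?thesis by simp
qed

text \<open>
  If \<open>w\<close> is a nonzero null vector of the reduced matrix, then \<open>U w\<close> is a nonzero vector with coordinate sum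
  \<open>0\<close> in the kernel of the information matrix. Together with the constant vector this makes the
  dimension of the kernel at least two, which contradicts the rank \<open>v - 1\<close>.
\<close>

lemma reduced_mat_eigenvalue_nonzero:
  assumes conn: "connected_design v r k1 k2 d"
  shows "poly (char_poly reduced_mat) 0 \<noteq> 0"
proof
  assume root: "poly (char_poly reduced_mat) 0 = 0"
  obtain w where "\<forall>h<r. (\<Sum>h'<r. gram h h' * w h') = sqnorm * (real r - 0) * w h"
    and pos: "0 < (\<Sum>h<r. (w h)\<^sup>2)"
    by (rule reduced_mat_eigenvector[OF root])
  then have w: "\<And>h. h < r \<Longrightarrow> (\<Sum>h'<r. gram h h' * w h') = sqnorm * real r * w h"
    by simp
  let ?C = "information_mat v r k1 k2 d"
  define x where "x i = (\<Sum>h<r. centred h i * w h)" for i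
  have r0: "0 < real r" using pos by (cases r) auto
  have norm: "0 < (\<Sum>i<v. (x i)\<^sup>2)"
    unfolding x_def by (subst gram_quadratic_form[where c = "sqnorm * real r"]) (use w sqnorm_pos r0 pos in auto)
  have sum_x: "(\<Sum>i<v. x i) = 0"
    unfolding x_def by (subst sum.swap) (simp add: sum_distrib_right[symmetric] sum_centred)
  have ux: "(\<Sum>j<v. centred h j * x j) = sqnorm * real r * w h" if "h < r" for h
  proof -
    have "(\<Sum>j<v. centred h j * x j) = (\<Sum>j<v. \<Sum>h'<r. centred h j * centred h' j * w h')"
      by (simp add: x_def sum_distrib_left mult.assoc)
    also have "\<dots> = (\<Sum>h'<r. gram h h' * w h')"
      by (subst sum.swap) (simp add: gram_def sum_distrib_right)
    finally show ?thesis using w that by simp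
  qed
  have C: "?C \<in> carrier_mat v v"
    unfolding information_mat_eq
    by (rule minus_carrier_mat) (rule mult_carrier_mat[OF contrast_mat_carrier weight_mat_carrier])
  obtain j where j: "j < v"
    "\<And>y. y \<in> carrier_vec v \<Longrightarrow> ?C *\<^sub>v y = 0\<^sub>v v \<Longrightarrow> y $ j = 0 \<Longrightarrow> y = 0\<^sub>v v"
    using rank_pred_kernel_coordinate[OF C] conn v_pos unfolding connected_design_def by auto
  \<comment> \<open>the combination of \<open>U w\<close> and the constant vector that vanishes at the critical coordinate\<close>
  define y where "y i = x i - x j" for i
  have "?C *\<^sub>v vec v y = 0\<^sub>v v"
  proof (rule eq_vecI)
    fix i assume "i < dim_vec (0\<^sub>v v :: real vec)"
    then have i: "i < v" by simp
    have "(\<Sum>j<v. y j) = - (real v * x j)"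
      by (simp add: y_def sum_subtractf sum_x)
    moreover have "(\<Sum>i<v. centred h i * y i) = sqnorm * real r * w h" if "h < r" for h
      using ux[OF that] sum_centred[OF that]
      by (simp add: y_def right_diff_distrib sum_subtractf sum_distrib_right[symmetric])
    then have "(\<Sum>h<r. centred h i * (\<Sum>j<v. centred h j * y j)) = sqnorm * real r * x i"
      by (simp add: x_def sum_distrib_left mult_ac)
    ultimately show "(?C *\<^sub>v vec v y) $ i = 0\<^sub>v v $ i"
      unfolding information_mat_mult_vec[OF i] using i v_pos sqnorm_pos by (simp add: y_def algebra_simps)
  qed (use C in auto)
  then have "vec v y = 0\<^sub>v v" using j by (simp add: y_def)
  then have const: "x i = x j" if "i < v" for i
    using that by (metis diff_eq_eq add_0 index_vec index_zero_vec(1) y_def)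
  then have "(\<Sum>i<v. x i) = real v * x j" by simp
  then have "x j = 0" using sum_x v_pos by simp
  then show False using norm const by simp
qed

lemma free_spectrum_exists:
  assumes conn: "connected_design v r k1 k2 d" and r: "r \<le> v - 1"
  obtains es where "free_spectrum v r k1 k2 d es"
proof -
  obtain es where es: "char_poly reduced_mat = (\<Prod>e\<leftarrow>es. [:- e, 1:])" "length es = r"
    by (rule char_poly_symmetric_splits[OF reduced_mat_carrier]) (auto simp: reduced_mat_def gram_sym)
  have ms: "eigenvalue_mset reduced_mat = mset es"
    unfolding eigenvalue_mset_def es(1) by (rule proots_linear_factors)
  have root: "poly (char_poly reduced_mat) e = 0" if "e \<in> set es" for e
    unfolding es(1) using that by (induction es) auto
  have bounds: "0 < e \<and> e \<le> real r" if "e \<in> set es" for e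
    using reduced_mat_eigenvalue_bounds[OF root[OF that]] reduced_mat_eigenvalue_nonzero[OF conn] root[OF that]
    by (cases "e = 0") auto
  have "sum_list es = (\<Sum>i<r. reduced_mat $$ (i, i))"
    by (rule sum_roots_eq_trace[OF reduced_mat_carrier es(1)])
  also have "\<dots> = real r * (real r - 1)"
    using sqnorm_pos by (simp add: reduced_mat_def gram_diag)
  finally have sum: "sum_list es = real r * (real r - 1)" .
  have "free_spectrum v r k1 k2 d (sort es)"
    unfolding free_spectrum_def eigenvalue_mset_information_mat[OF r] ms
    using bounds es(2) sum by (auto simp flip: sum_mset_sum_list)
  then show ?thesis using that by blast
qed

text \<open>
  Equal concurrences make the reduced matrix a scalar matrix minus one of rank at most one, and swapping
  the \<open>r \<times> 1\<close> and \<open>1 \<times> r\<close> factors of the latter leaves a \<open>1 \<times> 1\<close> problem. The floor in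
  the definition of the concurrence makes \<open>b\<close> nonpositive, so that the exceptional eigenvalue \<open>t\<close> is
  the largest one.
\<close>

lemma equal_concurrence_spectrum:
  assumes ecd: "equal_concurrence r (theta_bar k1 k2) d" and "2 \<le> r" "r \<le> v - 1"
    and conn: "connected_design v r k1 k2 d"
  obtains s t where "free_spectrum v r k1 k2 d (replicate (r - 1) s @ [t])"
proof -
  define b where "b = (real (theta_bar k1 k2) - (real k1)\<^sup>2 / real v) / sqnorm"
  have "real (theta_bar k1 k2) = of_int \<lfloor>(real k1)\<^sup>2 / real v\<rfloor>"
    unfolding theta_bar_def v by simp
  then have b: "b \<le> 0"
    using sqnorm_pos of_int_floor_le[of "(real k1)\<^sup>2 / real v"] unfolding b_def
    by (simp add: divide_nonpos_pos)
  have off: "gram h h' / sqnorm = b" if "h < r" "h' < r" "h \<noteq> h'" for h h'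
    using ecd that by (simp add: equal_concurrence_def gram_eq b_def)
  define s where "s = real r - 1 + b"
  define t where "t = s - real r * b"
  let ?A = "mat r 1 (\<lambda>_. 1) :: real mat" and ?B = "mat 1 r (\<lambda>_. b)"
  have "reduced_mat = s \<cdot>\<^sub>m 1\<^sub>m r - ?A * ?B"
    by (rule eq_matI) (use sqnorm_pos in \<open>auto simp: reduced_mat_def gram_diag off s_def scalar_prod_def\<close>)
  moreover have "s \<cdot>\<^sub>m 1\<^sub>m 1 - ?B * ?A = mat 1 1 (\<lambda>_. t)"
    by (rule eq_matI) (auto simp: scalar_prod_def t_def)
  moreover have "char_poly (mat 1 1 (\<lambda>_. t)) = [:- t, 1:]"
    by (simp add: char_poly_defs det_single)
  ultimately have "[:- s, 1:] ^ 1 * char_poly reduced_mat = [:- s, 1:] ^ r * [:- t, 1:]"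
    using char_poly_swap_product[of ?A r 1 ?B s] by simp
  also have "\<dots> = [:- s, 1:] ^ 1 * ([:- s, 1:] ^ (r - 1) * [:- t, 1:])"
    using \<open>2 \<le> r\<close> by (simp only: mult.assoc[symmetric] power_add[symmetric]) simp
  finally have cp: "char_poly reduced_mat = [:- s, 1:] ^ (r - 1) * [:- t, 1:]"
    by (subst (asm) mult_cancel_left) simp
  have ms: "eigenvalue_mset reduced_mat = mset (replicate (r - 1) s @ [t])"
    unfolding eigenvalue_mset_def cp by (subst proots_mult) (simp_all add: proots_power repeat_mset_single)
  obtain es where es: "free_spectrum v r k1 k2 d es"
    using free_spectrum_exists[OF conn \<open>r \<le> v - 1\<close>] .
  then have eq: "mset es = mset (replicate (r - 1) s @ [t])"
    unfolding free_spectrum_def eigenvalue_mset_information_mat[OF \<open>r \<le> v - 1\<close>] ms by simp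
  have "s \<le> t" using b by (simp add: t_def mult_nonneg_nonpos)
  then have "sorted (replicate (r - 1) s @ [t])" by (auto simp: sorted_append)
  with eq es have "es = replicate (r - 1) s @ [t]"
    unfolding free_spectrum_def by (metis properties_for_sort)
  then show ?thesis using es that by blast
qed

end

section \<open>Schur optimality and F-optimality\<close>

theorem theorem6:
  fixes k1 k2 v r :: nat and dbar :: design
  assumes "k1 \<ge> k2" and "k2 \<ge> 2" and "v = k1 + k2" and "2 \<le> r" and "r \<le> v - 1"
    and "dbar \<in> design_class v r k1 k2"
    and "equal_concurrence r (theta_bar k1 k2) dbar"
  shows "(\<forall>d \<in> design_class v r k1 k2.
            eigenvalue_mset (information_mat v r k1 k2 d) \<noteq>
              eigenvalue_mset (information_mat v r k1 k2 dbar) \<longrightarrow>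
            (Schur_better v r k1 k2 dbar d \<longleftrightarrow> psi_F v r k1 k2 dbar \<le> psi_F v r k1 k2 d))
         \<and> (Schur_optimal v r k1 k2 dbar \<longleftrightarrow> F_optimal v r k1 k2 dbar)"
proof -
  have design: "two_block_design v r k1 k2 d \<and> connected_design v r k1 k2 d"
    if "d \<in> design_class v r k1 k2" for d
    using that assms by (auto simp: design_class_def two_block_design_def)
  obtain s t where bar: "free_spectrum v r k1 k2 dbar (replicate (r - 1) s @ [t])"
    using two_block_design.equal_concurrence_spectrum[of v r k1 k2 dbar] design[OF assms(6)] assms by blast
  have spectrum: "\<exists>es. free_spectrum v r k1 k2 d es" if "d \<in> design_class v r k1 k2" for d
    using two_block_design.free_spectrum_exists[of v r k1 k2 d] design[OF that] assms(5) by blast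
  have order: "(\<forall>f. convex_on {0<..} f \<longrightarrow> psi v r k1 k2 f dbar \<le> psi v r k1 k2 f d) \<longleftrightarrow>
      psi_F v r k1 k2 dbar \<le> psi_F v r k1 k2 d" if "d \<in> design_class v r k1 k2" for d
    using psi_le_iff_psi_F_le[OF bar] spectrum[OF that] assms(4,5) by blast
  have square: "convex_on {0<..} (\<lambda>x :: real. x\<^sup>2)"
    by (rule convex_on_subset[OF convex_power2]) auto
  have "Schur_better v r k1 k2 dbar d \<longleftrightarrow> psi_F v r k1 k2 dbar \<le> psi_F v r k1 k2 d"
    if "d \<in> design_class v r k1 k2"
      and "eigenvalue_mset (information_mat v r k1 k2 d) \<noteq> eigenvalue_mset (information_mat v r k1 k2 dbar)" for d
    using order[OF that(1)] psi_square_less[OF bar _ assms(4,5) _ that(2)] spectrum[OF that(1)] square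
    unfolding Schur_better_def by blast
  moreover have "Schur_optimal v r k1 k2 dbar \<longleftrightarrow> F_optimal v r k1 k2 dbar"
    using order unfolding Schur_optimal_def F_optimal_def by blast
  ultimately show ?thesis by blast
qed

end
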